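(* Let $\{\epsilon_l\}_{l\in\mathbb N}$ be a sequence of positive reals and $\{M_l\},\{k_l\},\{n_l\}$ sequences in $\mathbb N$ with $k_l\to\infty$ as $l\to\infty$. For each $l$ let $\mathcal P_l\subset P_{k_l(n_l+M_l)}$ be an $\epsilon_l$-independent set (with parameters $k_l,n_l,M_l$) and let $h_l:P\to\mathbb R$ be a function. Put $a_i=(i-1)(n_l+M_l)$ and $s_l^2=\sum_{i=1}^{k_l}\sigma^2_{\mathcal P_l}(S_{a_i}^{n_l}h_l)$. Assume the oscillation condition $$\lim_{l\to\infty}\frac1{s_l^j}\sum_{i=1}^{k_l}\int\left(\omega_{a_i}^{n_l}(h_l,4\epsilon_l,p)\right)^j d\nu_{\mathcal P_l}(p)=0,\qquad j=1,2,$$ and the gap condition $$\lim_{l\to\infty}\frac1{s_l^2}\,\sigma^2_{\mathcal P_l}\left(\sum_{i=1}^{k_l}S_{a_i+n_l}^{M_l}h_l\right)=0.$$ Then the Lindeberg condition $$\lim_{l\to\infty}\frac1{s_l^2}\sum_{i=1}^{k_l}L_{\mathcal P_l}(S_{a_i}^{n_l}h_l,\eta s_l)=0\qquad\text{for all }\eta>0$$ implies the central limit theorem: for every $t\in\mathbb R$, $$\lim_{l\to\infty}\nu_{\mathcal P_l}\left(\Big\{S^{k_l(n_l+M_l)}h_l-\mathbb E_{\mathcal P_l}\big(S^{k_l(n_l+M_l)}h_l\big)\leqslant t s_l\Big\}\right)=\mathcal N(t).$$ If in addition $$\lim_{l\to\infty}\frac1{\sigma^2_{\mathcal P_l}(S^{n_l}h_l)}\int\left(\omega^{n_l}(h_l,2\epsilon_l,p)\right)^2d\nu_{\mathcal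 P_l}(p)=0,$$ then the Lindeberg condition is also necessary, i.e. if $$\lim_{l\to\infty}\nu_{\mathcal P_l}\left(\Big\{S^{k_l(n_l+M_l)}h_l-\mathbb E_{\mathcal P_l}\big(S^{k_l(n_l+M_l)}h_l\big)\leqslant t s_l\Big\}\right)=\mathcal N(t)\qquad\text{for every }t\in\mathbb R,$$ then $$\lim_{l\to\infty}\frac1{s_l^2}\sum_{i=1}^{k_l}L_{\mathcal P_l}(S_{a_i}^{n_l}h_l,\eta s_l)=0\qquad\text{for all }\eta>0.$$
   Context: $(X,d)$ is a compact metric space and $T:X\to X$ is continuous. $P_n=\{x\in X: T^nx=x\}$, $P=\bigcup_{n\in\mathbb N}P_n$; each $P_n$ is assumed finite. $d_n(x,y)=\sup_{0\leqslant k\leqslant n-1}d(T^kx,T^ky)$ and $B^n_\epsilon(x)=\{y\in X:d_n(x,y)<\epsilon\}$. A set $E\subset X$ is $(n,\epsilon)$-spanning for $Y$ (or $(n,\epsilon)$-spans $Y$) if $Y\subset\bigcup_{x\in E}B^n_\epsilon(x)$. $\epsilon$-independence: for $\epsilon>0$ and $k,n,M\in\mathbb N$, a set $\mathcal P\subset P_{k(n+M)}$ is $\epsilon$-independent if there exist a subset $E\subset P_{n+M}$ which $(n,3\epsilon)$-spans $P_{k(n+M)}$ and a bijection $\Phi:E^k\to\mathcal P$ such that $T^{(i-1)(n+M)}(\Phi(\mathbf x))\in B^n_\epsilon(x_i)$ for all $\mathbf x=(x_1,\dots,x_k)\in E^k$ and $1\leqslant i\leqslant k$. For a finite set $Z\subset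 X$, $\nu_Z$ is the uniform probability on $Z$, and $\mathbb E_Z$, $\sigma_Z^2$ are the expectation and variance with respect to $\nu_Z$. The Lindeberg function is $L_Z(h,\eta)=\int (h-\mathbb E_Z(h))^2\,\mathbb 1_{\{|h-\mathbb E_Z(h)|>\eta\}}\,d\nu_Z$. Birkhoff sums: $S_m^nh(x)=\sum_{i=m}^{m+n-1}h(T^ix)$ and $S^nh=S_0^nh$. Oscillations (for $h:P\to\mathbb R$): $\omega_m^n(h,\epsilon,x)=\sup\{|S_m^nh(x)-S^nh(y)|: y\in B^n_\epsilon(T^mx)\cap P\}$ and $\omega^n=\omega^n_0$. $\mathcal N(t)=\frac1{\sqrt{2\pi}}\int_{-\infty}^te^{-u^2/2}du$. It is understood that the quantities appearing in denominators are positive. *)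

theory Defs
  imports "HOL-Probability.Probability"
begin

text \<open>
  The natural numbers serving as periods, orbit lengths, gaps and numbers of blocks are positive.
\<close>

definition period_pts :: "('a \<Rightarrow> 'a) \<Rightarrow> nat \<Rightarrow> 'a set" where
  "period_pts T n = {x. (T ^^ n) x = x}"

definition periodic_pts :: "('a \<Rightarrow> 'a) \<Rightarrow> 'a set" where
  "periodic_pts T = (\<Union>n\<in>{1..}. period_pts T n)"

definition bowen_dist :: "('a::metric_space \<Rightarrow> 'a) \<Rightarrow> nat \<Rightarrow> 'a \<Rightarrow> 'a \<Rightarrow> real" where
  "bowen_dist T n x y = (SUP k\<in>{0..n - 1}. dist ((T ^^ k) x) ((T ^^ k) y))"

definition bowen_ball :: "('a::metric_space \<Rightarrow> 'a) \<Rightarrow> nat \<Rightarrow> real \<Rightarrow> 'a \<Rightarrow> 'a set" where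
  "bowen_ball T n \<epsilon> x = {y. bowen_dist T n x y < \<epsilon>}"

definition spans :: "('a::metric_space \<Rightarrow> 'a) \<Rightarrow> nat \<Rightarrow> real \<Rightarrow> 'a set \<Rightarrow> 'a set \<Rightarrow> bool" where
  "spans T n \<epsilon> E Y \<longleftrightarrow> Y \<subseteq> (\<Union>x\<in>E. bowen_ball T n \<epsilon> x)"

text \<open>
  The power \<open>E\<^sup>k\<close> is rendered as the set of extensional functions from \<open>{1..k}\<close> to \<open>E\<close>.
\<close>

definition eps_independent ::
  "('a::metric_space \<Rightarrow> 'a) \<Rightarrow> real \<Rightarrow> nat \<Rightarrow> nat \<Rightarrow> nat \<Rightarrow> 'a set \<Rightarrow> bool" where
  "eps_independent T \<epsilon> k n M Z \<longleftrightarrow>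
     Z \<subseteq> period_pts T (k * (n + M)) \<and>
     (\<exists>E \<Phi>. E \<subseteq> period_pts T (n + M) \<and>
        spans T n (3 * \<epsilon>) E (period_pts T (k * (n + M))) \<and>
        bij_betw \<Phi> ({1..k} \<rightarrow>\<^sub>E E) Z \<and>
        (\<forall>x\<in>{1..k} \<rightarrow>\<^sub>E E. \<forall>i\<in>{1..k}.
           (T ^^ ((i - 1) * (n + M))) (\<Phi> x) \<in> bowen_ball T n \<epsilon> (x i)))"

definition unif :: "'a set \<Rightarrow> 'a measure" where
  "unif Z = uniform_count_measure Z"

definition expect :: "'a set \<Rightarrow> ('a \<Rightarrow> real) \<Rightarrow> real" where
  "expect Z f = (\<integral>p. f p \<partial>unif Z)"

definition var :: "'a set \<Rightarrow> ('a \<Rightarrow> real) \<Rightarrow> real" where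
  "var Z f = (\<integral>p. (f p - expect Z f)\<^sup>2 \<partial>unif Z)"

definition lindeberg :: "'a set \<Rightarrow> ('a \<Rightarrow> real) \<Rightarrow> real \<Rightarrow> real" where
  "lindeberg Z f \<eta> =
     (\<integral>p. (f p - expect Z f)\<^sup>2 * indicator {x. \<bar>f x - expect Z f\<bar> > \<eta>} p \<partial>unif Z)"

definition birkhoff :: "('a \<Rightarrow> 'a) \<Rightarrow> nat \<Rightarrow> nat \<Rightarrow> ('a \<Rightarrow> real) \<Rightarrow> 'a \<Rightarrow> real" where
  "birkhoff T m n h x = (\<Sum>i = m..<m + n. h ((T ^^ i) x))"

text \<open>
  The oscillation takes values in \<open>[0, \<infinity>]\<close>: the observable \<open>h\<close> is arbitrary and the set of periodic
  points may be infinite, so the supremum need not be finite.  An observable on the periodic points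
  is represented by a total function; only its values on periodic points enter.
\<close>

definition osc ::
  "('a::metric_space \<Rightarrow> 'a) \<Rightarrow> nat \<Rightarrow> nat \<Rightarrow> ('a \<Rightarrow> real) \<Rightarrow> real \<Rightarrow> 'a \<Rightarrow> ennreal" where
  "osc T m n h \<epsilon> x =
     (SUP y\<in>bowen_ball T n \<epsilon> ((T ^^ m) x) \<inter> periodic_pts T.
        ennreal \<bar>birkhoff T m n h x - birkhoff T 0 n h y\<bar>)"

definition normal_cdf :: "real \<Rightarrow> real" where
  "normal_cdf t = 1 / sqrt (2 * pi) * (LBINT u:{..t}. exp (- u\<^sup>2 / 2))"

end

theory Submission
  imports Defs
begin

text \<open>
  The idea is to replace the Birkhoff sum over the \<open>i\<close>-th block of a point \<open>p\<close> of \<open>Z\<close> by the Birkhoff sum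
  at the point \<open>x\<^sub>i\<close> of \<open>E\<close> whose orbit \<open>p\<close> shadows along that block.  Since \<open>\<Phi>\<close> is a bijection from \<open>E\<^sup>k\<close>
  onto \<open>Z\<close>, the points \<open>x\<^sub>1, \<dots>, x\<^sub>k\<close> are independent and uniformly distributed on \<open>E\<close> under the uniform
  probability on \<open>Z\<close> (\<open>integral_prod_coordinates\<close>).  So the replacements form an array with independent
  and identically distributed rows, even though the blocks themselves need not be
  independent.

  The error of the replacement is at most the oscillation of the block
  (\<open>abs_birkhoff_diff_le_osc\<close>).  The case \<open>j = 2\<close> of the oscillation condition says that the errors are
  small in \<open>L\<^sup>2\<close>; hence the total variance is asymptotically unchanged and the Lindeberg conditions for
  the blocks and for the replacements are equivalent (\<open>variance_coord_lim\<close>,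
  \<open>lindeberg_iff_lindeberg_coord\<close>).  The case \<open>j = 1\<close>, together with the gap condition, says that the
  normalised total sums differ by a quantity tending to \<open>0\<close> in \<open>L\<^sup>1\<close>; hence their characteristic
  functions have the same limits (\<open>char_\<nu>_sub_char_power_lim\<close>).

  What remains is the theorem of Lindeberg and Feller for identically distributed rows.  Let \<open>\<phi>\<close> be the
  characteristic function of a normalised entry.  The entries are uniformly negligible because \<open>k\<close>
  tends to infinity, so \<open>\<phi> t ^ k - exp (k * (\<phi> t - 1))\<close> tends to \<open>0\<close> (\<open>char_power_sub_exp_lim\<close>).
  Under the Lindeberg condition a second-order expansion gives \<open>k * (\<phi> t - 1) \<longlonglongrightarrow> - t\<^sup>2 / 2\<close>.  Conversely,
  if the row sums are asymptotically normal, then the real parts of \<open>k * (\<phi> t - 1)\<close> converge to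
  \<open>- t\<^sup>2 / 2\<close>, and nonnegativity of \<open>cos u - 1 + u\<^sup>2 / 2\<close> bounds the Lindeberg tails.  Levy's continuity theorem
  translates between characteristic functions and distribution functions.

  Both implications of the theorem are therefore the two directions of the single equivalence
  \<open>lindeberg_iff_clt\<close>.
\<close>

section \<open>The Lindeberg--Feller theorem for identically distributed rows\<close>

text \<open>
  Powers are traded for exponentials because \<open>k * (z - 1)\<close> is linear in the characteristic function:
  the sufficiency and the necessity of the Lindeberg condition then both come down to the limit of
  this one quantity.  Both bases \<open>z\<close> and \<open>exp (z - 1)\<close> lie in the closed unit disc, so taking \<open>k\<close>-th
  powers multiplies their distance, which is of second order in \<open>z - 1\<close>, by at most \<open>k\<close>.
\<close>

lemma norm_power_sub_exp_le:
  fixes z :: complex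
  assumes "norm z \<le> 1" "norm (z - 1) \<le> 1"
  shows "norm (z ^ k - exp (of_nat k * (z - 1))) \<le> 3 * real k * (norm (z - 1))\<^sup>2"
proof -
  have Re: "\<bar>Re (z - 1)\<bar> \<le> 1" "Re z \<le> 1"
    using abs_Re_le_cmod[of "z - 1"] complex_Re_le_cmod[of z] assms by linarith+
  have "norm (exp (z - 1) - z) \<le> exp \<bar>Re (z - 1)\<bar> * (norm (z - 1))\<^sup>2"
    using Taylor_exp[of "z - 1" 1] by (simp add: numeral_2_eq_2)
  also have "exp \<bar>Re (z - 1)\<bar> \<le> 3"
    using Re(1) exp_le by (smt (verit) exp_le_cancel_iff)
  finally have one: "norm (z - exp (z - 1)) \<le> 3 * (norm (z - 1))\<^sup>2"
    by (simp add: norm_minus_commute mult_right_mono)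
  have "norm (z ^ k - exp (z - 1) ^ k) \<le> real k * norm (z - exp (z - 1))"
    using assms Re by (intro norm_power_diff) simp_all
  also have "\<dots> \<le> real k * (3 * (norm (z - 1))\<^sup>2)"
    using one by (rule mult_left_mono) simp
  finally show ?thesis
    by (simp add: exp_of_nat_mult mult_ac)
qed

text \<open>
  The \<open>l\<close>-th row of the array consists of \<open>k l\<close> independent variables with common law \<open>\<mu> l\<close>, so the
  characteristic function of the row sum is \<open>char (\<mu> l) t ^ k l\<close>.  The variance of the row sum is
  only required to tend to \<open>1\<close>: the rows below are normalised by the standard deviation of
  another array that they approximate.
\<close>

locale centred_L2_rows =
  fixes \<mu> :: "nat \<Rightarrow> real measure" and k :: "nat \<Rightarrow> nat"
  assumes distribution: "\<And>l. real_distribution (\<mu> l)"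
    and square_integrable: "\<And>l. integrable (\<mu> l) (\<lambda>x. x\<^sup>2)"
    and centred: "\<And>l. (LINT x|\<mu> l. x) = 0"
    and k_at_top: "filterlim k at_top sequentially"
    and variance_lim: "(\<lambda>l. real (k l) * (LINT x|\<mu> l. x\<^sup>2)) \<longlonglongrightarrow> 1"
begin

sublocale \<mu>: real_distribution "\<mu> l" for l
  by (rule distribution)

lemma integrable_identity: "integrable (\<mu> l) (\<lambda>x. x)"
  by (rule \<mu>.square_integrable_imp_integrable[OF _ square_integrable]) simp

lemma integrable_tail: "integrable (\<mu> l) (\<lambda>x. x\<^sup>2 * indicator {x. \<bar>x\<bar> > \<eta>} x)"
  by (rule Bochner_Integration.integrable_bound[OF square_integrable[of l]])
     (auto simp: indicator_def)

lemma char_second_order: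
  "norm (char (\<mu> l) t - 1 + t\<^sup>2 / 2 * (LINT x|\<mu> l. x\<^sup>2))
     \<le> t\<^sup>2 / 6 * (LINT x|\<mu> l. min (6 * x\<^sup>2) (\<bar>t\<bar> * \<bar>x\<bar> ^ 3))"
  using \<mu>.char_approx3[of l "LINT x|\<mu> l. x\<^sup>2" t]
    integrable_identity square_integrable centred
  by (simp add: algebra_simps)

lemma integrable_min: "integrable (\<mu> l) (\<lambda>x. min (6 * x\<^sup>2) (\<bar>t\<bar> * \<bar>x\<bar> ^ 3))"
  by (rule Bochner_Integration.integrable_bound[of _ "\<lambda>x. 6 * x\<^sup>2"])
    (auto simp: square_integrable)

lemma norm_char_sub_one_le: "norm (char (\<mu> l) t - 1) \<le> 3 / 2 * t\<^sup>2 * (LINT x|\<mu> l. x\<^sup>2)"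
proof -
  let ?v = "LINT x|\<mu> l. x\<^sup>2"
  have "(LINT x|\<mu> l. min (6 * x\<^sup>2) (\<bar>t\<bar> * \<bar>x\<bar> ^ 3)) \<le> (LINT x|\<mu> l. 6 * x\<^sup>2)"
    by (intro integral_mono integrable_min) (auto simp: square_integrable)
  hence "t\<^sup>2 / 6 * (LINT x|\<mu> l. min (6 * x\<^sup>2) (\<bar>t\<bar> * \<bar>x\<bar> ^ 3)) \<le> t\<^sup>2 / 6 * (6 * ?v)"
    by (intro mult_left_mono) auto
  with char_second_order[of l t] have "norm (char (\<mu> l) t - 1 + t\<^sup>2 / 2 * ?v) \<le> t\<^sup>2 * ?v"
    by simp
  moreover have "norm (char (\<mu> l) t - 1)
      \<le> norm (char (\<mu> l) t - 1 + t\<^sup>2 / 2 * ?v) + norm (complex_of_real (t\<^sup>2 / 2 * ?v))"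
    by (metis add_diff_cancel_right' norm_triangle_ineq4 of_real_mult)
  ultimately show ?thesis
    by (simp add: norm_mult del: of_real_mult)
qed

text \<open>
  The entries of a row are uniformly negligible, because equally many variances share a total that
  stays close to \<open>1\<close>.  In Feller's theorem this is what makes the Lindeberg condition necessary.
\<close>

lemma second_moment_lim: "(\<lambda>l. LINT x|\<mu> l. x\<^sup>2) \<longlonglongrightarrow> 0"
proof -
  have "(\<lambda>l. (real (k l) * (LINT x|\<mu> l. x\<^sup>2)) * inverse (real (k l))) \<longlonglongrightarrow> 1 * 0"
    by (intro tendsto_mult variance_lim tendsto_inverse_0_at_top
        filterlim_compose[OF filterlim_real_sequentially k_at_top])
  moreover have "\<forall>\<^sub>F l in sequentially. k l > 0"
    using k_at_top unfolding filterlim_at_top by (auto elim!: allE[of _ 1] eventually_mono)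
  hence "\<forall>\<^sub>F l in sequentially.
      (real (k l) * (LINT x|\<mu> l. x\<^sup>2)) * inverse (real (k l)) = (LINT x|\<mu> l. x\<^sup>2)"
    by (rule eventually_mono) (simp add: field_simps)
  ultimately show ?thesis
    using Lim_transform_eventually by fastforce
qed

text \<open>
  The error is at most a multiple of \<open>k * \<sigma>\<^sup>4\<close>, where \<open>\<sigma>\<^sup>2\<close> is the variance of an entry:
  \<open>k * \<sigma>\<^sup>2\<close> stays bounded and \<open>\<sigma>\<^sup>2\<close> tends to \<open>0\<close>.
\<close>

lemma char_power_sub_exp_lim:
  "(\<lambda>l. char (\<mu> l) t ^ k l - exp (of_nat (k l) * (char (\<mu> l) t - 1))) \<longlonglongrightarrow> 0"
proof (rule Lim_null_comparison)
  let ?v = "\<lambda>l. LINT x|\<mu> l. x\<^sup>2"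
  let ?b = "\<lambda>l. 3 / 2 * t\<^sup>2 * ?v l"
  have "?b \<longlonglongrightarrow> 3 / 2 * t\<^sup>2 * 0"
    by (intro tendsto_intros second_moment_lim)
  hence "\<forall>\<^sub>F l in sequentially. ?b l < 1"
    by (rule order_tendstoD) simp
  thus "\<forall>\<^sub>F l in sequentially. norm (char (\<mu> l) t ^ k l - exp (of_nat (k l) * (char (\<mu> l) t - 1)))
      \<le> 27 / 4 * t ^ 4 * (real (k l) * ?v l) * ?v l"
  proof (rule eventually_mono)
    fix l assume "?b l < 1"
    hence "norm (char (\<mu> l) t ^ k l - exp (of_nat (k l) * (char (\<mu> l) t - 1)))
        \<le> 3 * real (k l) * (norm (char (\<mu> l) t - 1))\<^sup>2"
      using norm_char_sub_one_le[of l t] \<mu>.cmod_char_le_1[of l t]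
      by (intro norm_power_sub_exp_le) linarith+
    also have "\<dots> \<le> 3 * real (k l) * (?b l)\<^sup>2"
      by (intro mult_left_mono power_mono norm_char_sub_one_le) auto
    finally show "norm (char (\<mu> l) t ^ k l - exp (of_nat (k l) * (char (\<mu> l) t - 1)))
      \<le> 27 / 4 * t ^ 4 * (real (k l) * ?v l) * ?v l"
      by (simp add: power2_eq_square power4_eq_xxxx algebra_simps)
  qed
  have "(\<lambda>l. 27 / 4 * t ^ 4 * (real (k l) * ?v l) * ?v l) \<longlonglongrightarrow> 27 / 4 * t ^ 4 * 1 * 0"
    by (intro tendsto_intros second_moment_lim variance_lim)
  thus "(\<lambda>l. 27 / 4 * t ^ 4 * (real (k l) * ?v l) * ?v l) \<longlonglongrightarrow> 0"
    by simp
qed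

text \<open>
  The cubic bound on the Taylor remainder serves below the level \<open>\<eta>\<close>, where it costs a factor \<open>\<eta>\<close>,
  and the quadratic bound above it, where it costs a Lindeberg tail.
\<close>

lemma expectation_min_le:
  assumes "\<eta> > 0"
  shows "(LINT x|\<mu> l. min (6 * x\<^sup>2) (\<bar>t\<bar> * \<bar>x\<bar> ^ 3))
     \<le> 6 * (LINT x|\<mu> l. x\<^sup>2 * indicator {x. \<bar>x\<bar> > \<eta>} x) + \<bar>t\<bar> * \<eta> * (LINT x|\<mu> l. x\<^sup>2)"
proof -
  have "(LINT x|\<mu> l. min (6 * x\<^sup>2) (\<bar>t\<bar> * \<bar>x\<bar> ^ 3))
      \<le> (LINT x|\<mu> l. 6 * (x\<^sup>2 * indicator {x. \<bar>x\<bar> > \<eta>} x) + \<bar>t\<bar> * \<eta> * x\<^sup>2)"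
  proof (rule integral_mono)
    show "integrable (\<mu> l) (\<lambda>x. 6 * (x\<^sup>2 * indicator {x. \<bar>x\<bar> > \<eta>} x) + \<bar>t\<bar> * \<eta> * x\<^sup>2)"
      using integrable_tail square_integrable by simp
    fix x :: real
    show "min (6 * x\<^sup>2) (\<bar>t\<bar> * \<bar>x\<bar> ^ 3) \<le> 6 * (x\<^sup>2 * indicator {x. \<bar>x\<bar> > \<eta>} x) + \<bar>t\<bar> * \<eta> * x\<^sup>2"
    proof (cases "\<bar>x\<bar> > \<eta>")
      case True
      thus ?thesis using assms by (simp add: min.coboundedI1)
    next
      case False
      hence "\<bar>t\<bar> * (\<bar>x\<bar> * \<bar>x\<bar>\<^sup>2) \<le> \<bar>t\<bar> * (\<eta> * \<bar>x\<bar>\<^sup>2)"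
        by (intro mult_left_mono mult_right_mono) auto
      thus ?thesis using False by (simp add: min.coboundedI2 power3_eq_cube power2_eq_square mult_ac)
    qed
  qed (rule integrable_min)
  thus ?thesis
    using integrable_tail square_integrable by simp
qed

text \<open>
  By the second-order expansion, \<open>k * (char \<mu> t - 1)\<close> differs from \<open>- t\<^sup>2 / 2 * (k * \<sigma>\<^sup>2)\<close> by at most a
  Lindeberg tail at level \<open>\<eta>\<close> plus a multiple of \<open>\<eta>\<close>, for every \<open>\<eta>\<close>.
\<close>

lemma lindeberg_imp_char_power_lim:
  assumes lindeberg:
    "\<And>\<eta>. \<eta> > 0 \<Longrightarrow> (\<lambda>l. real (k l) * (LINT x|\<mu> l. x\<^sup>2 * indicator {x. \<bar>x\<bar> > \<eta>} x)) \<longlonglongrightarrow> 0"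
  shows "(\<lambda>l. char (\<mu> l) t ^ k l) \<longlonglongrightarrow> exp (- (t\<^sup>2) / 2)"
proof -
  let ?v = "\<lambda>l. LINT x|\<mu> l. x\<^sup>2"
  let ?L = "\<lambda>\<eta> l. LINT x|\<mu> l. x\<^sup>2 * indicator {x. \<bar>x\<bar> > \<eta>} x"
  let ?d = "\<lambda>l. complex_of_real (real (k l)) * (char (\<mu> l) t - 1 + t\<^sup>2 / 2 * ?v l)"
  have bound: "norm (?d l) \<le> t\<^sup>2 * (real (k l) * ?L \<eta> l) + t\<^sup>2 * \<bar>t\<bar> * \<eta> / 6 * (real (k l) * ?v l)"
    if "\<eta> > 0" for \<eta> l
  proof -
    have "norm (?d l) \<le> real (k l) * (t\<^sup>2 / 6 * (6 * ?L \<eta> l + \<bar>t\<bar> * \<eta> * ?v l))"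
      unfolding norm_mult
      using order_trans[OF char_second_order mult_left_mono[OF expectation_min_le[OF that]]]
      by (intro mult_mono) simp_all
    thus ?thesis by (simp add: algebra_simps)
  qed
  have "?d \<longlonglongrightarrow> 0"
  proof (rule tendstoI)
    fix e :: real assume "e > 0"
    define \<eta> where "\<eta> = e / (t\<^sup>2 * \<bar>t\<bar> + 1)"
    have pos: "t\<^sup>2 * \<bar>t\<bar> + 1 > 0" by (simp add: add_nonneg_pos)
    have "\<eta> > 0" using \<open>e > 0\<close> pos by (simp add: \<eta>_def)
    have "t\<^sup>2 * \<bar>t\<bar> * \<eta> < e"
      using pos \<open>e > 0\<close> by (simp add: \<eta>_def field_simps)
    hence small: "t\<^sup>2 * \<bar>t\<bar> * \<eta> / 6 < e" using \<open>e > 0\<close> by simp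
    have "(\<lambda>l. t\<^sup>2 * (real (k l) * ?L \<eta> l) + t\<^sup>2 * \<bar>t\<bar> * \<eta> / 6 * (real (k l) * ?v l))
        \<longlonglongrightarrow> t\<^sup>2 * 0 + t\<^sup>2 * \<bar>t\<bar> * \<eta> / 6 * 1"
      by (intro tendsto_intros lindeberg variance_lim \<open>\<eta> > 0\<close>)
    hence "\<forall>\<^sub>F l in sequentially.
        t\<^sup>2 * (real (k l) * ?L \<eta> l) + t\<^sup>2 * \<bar>t\<bar> * \<eta> / 6 * (real (k l) * ?v l) < e"
      by (rule order_tendstoD) (use small in simp)
    thus "\<forall>\<^sub>F l in sequentially. dist (?d l) 0 < e"
      by (rule eventually_mono) (unfold dist_0_norm dist_commute[of _ 0], rule le_less_trans[OF bound[OF \<open>\<eta> > 0\<close>]])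
  qed
  hence "(\<lambda>l. ?d l - complex_of_real (t\<^sup>2 / 2 * (real (k l) * ?v l))) \<longlonglongrightarrow> 0 - complex_of_real (t\<^sup>2 / 2 * 1)"
    by (intro tendsto_diff tendsto_of_real tendsto_mult_left variance_lim)
  hence "(\<lambda>l. of_nat (k l) * (char (\<mu> l) t - 1)) \<longlonglongrightarrow> complex_of_real (- (t\<^sup>2) / 2)"
    by (simp add: algebra_simps)
  hence "(\<lambda>l. exp (of_nat (k l) * (char (\<mu> l) t - 1))) \<longlonglongrightarrow> exp (complex_of_real (- (t\<^sup>2) / 2))"
    by (rule tendsto_exp)
  from tendsto_add[OF char_power_sub_exp_lim[of t] this] show ?thesis
    by (simp flip: exp_of_real)
qed

text \<open>
  Taking moduli in \<open>exp (k * (char \<mu> t - 1))\<close> shows that \<open>k\<close> times the integral of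
  \<open>cos (t * x) - 1 + t\<^sup>2 * x\<^sup>2 / 2\<close> tends to \<open>0\<close>.  This integrand is nonnegative, and for large \<open>t\<close> it
  dominates a multiple of \<open>x\<^sup>2\<close> on \<open>{\<bar>x\<bar> > \<eta>}\<close>, so a single value of \<open>t\<close> controls the tail.
\<close>

lemma char_power_lim_imp_lindeberg:
  assumes gaussian: "\<And>t. (\<lambda>l. char (\<mu> l) t ^ k l) \<longlonglongrightarrow> exp (- (t\<^sup>2) / 2)"
    and "\<eta> > 0"
  shows "(\<lambda>l. real (k l) * (LINT x|\<mu> l. x\<^sup>2 * indicator {x. \<bar>x\<bar> > \<eta>} x)) \<longlonglongrightarrow> 0"
proof -
  let ?v = "\<lambda>l. LINT x|\<mu> l. x\<^sup>2"
  let ?L = "\<lambda>l. LINT x|\<mu> l. x\<^sup>2 * indicator {x. \<bar>x\<bar> > \<eta>} x"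
  \<comment> \<open>Chosen so that half of the quadratic term absorbs the at most 2 lost to the cosine when \<open>\<bar>x\<bar> > \<eta>\<close>.\<close>
  define t where "t = sqrt 8 / \<eta>"
  have t2: "t\<^sup>2 / 2 = 4 / \<eta>\<^sup>2" by (simp add: t_def power_divide)
  have Re_char: "Re (char (\<mu> l) t) = (LINT x|\<mu> l. cos (t * x))" for l
    unfolding char_def by (subst integral_Re[symmetric]) (auto simp: \<mu>.integrable_iexp Re_exp)
  have int_cos: "integrable (\<mu> l) (\<lambda>x. cos (t * x))" for l
    by (rule \<mu>.integrable_const_bound[of _ 1]) auto
  have "(\<lambda>l. exp (of_nat (k l) * (char (\<mu> l) t - 1))) \<longlonglongrightarrow> complex_of_real (exp (- (t\<^sup>2) / 2))"
    using tendsto_diff[OF gaussian[of t] char_power_sub_exp_lim[of t]] by simp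
  hence "(\<lambda>l. norm (exp (of_nat (k l) * (char (\<mu> l) t - 1)))) \<longlonglongrightarrow> norm (complex_of_real (exp (- (t\<^sup>2) / 2)))"
    by (rule tendsto_norm)
  hence "(\<lambda>l. exp (real (k l) * (Re (char (\<mu> l) t) - 1))) \<longlonglongrightarrow> exp (- (t\<^sup>2) / 2)"
    by simp
  from tendsto_ln[OF this] have "(\<lambda>l. real (k l) * (Re (char (\<mu> l) t) - 1)) \<longlonglongrightarrow> - (t\<^sup>2) / 2"
    by simp
  from tendsto_add[OF this tendsto_mult_left[OF variance_lim, of "t\<^sup>2 / 2"]]
  have lim: "(\<lambda>l. real (k l) * (Re (char (\<mu> l) t) - 1 + t\<^sup>2 / 2 * ?v l)) \<longlonglongrightarrow> 0"
    by (simp add: algebra_simps)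
  have bound: "2 / \<eta>\<^sup>2 * ?L l \<le> Re (char (\<mu> l) t) - 1 + t\<^sup>2 / 2 * ?v l" for l
  proof -
    have "(LINT x|\<mu> l. 2 / \<eta>\<^sup>2 * (x\<^sup>2 * indicator {x. \<bar>x\<bar> > \<eta>} x))
        \<le> (LINT x|\<mu> l. cos (t * x) - 1 + t\<^sup>2 / 2 * x\<^sup>2)"
    proof (rule integral_mono)
      fix x :: real
      show "2 / \<eta>\<^sup>2 * (x\<^sup>2 * indicator {x. \<bar>x\<bar> > \<eta>} x) \<le> cos (t * x) - 1 + t\<^sup>2 / 2 * x\<^sup>2"
      proof (cases "\<bar>x\<bar> > \<eta>")
        case True
        hence "\<eta>\<^sup>2 \<le> x\<^sup>2"
          using \<open>\<eta> > 0\<close> by (metis less_eq_real_def abs_le_square_iff abs_of_pos)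
        hence "2 \<le> 2 / \<eta>\<^sup>2 * x\<^sup>2" using \<open>\<eta> > 0\<close> by (simp add: field_simps)
        moreover have "t\<^sup>2 / 2 * x\<^sup>2 = 2 * (2 / \<eta>\<^sup>2 * x\<^sup>2)"
          by (simp add: t2)
        moreover have "x\<^sup>2 * indicator {x. \<bar>x\<bar> > \<eta>} x = x\<^sup>2"
          using True by simp
        ultimately show ?thesis
          using cos_ge_minus_one[of "t * x"] by (simp only:)
      next
        case False
        have "1 - cos (t * x) \<le> (t * x)\<^sup>2 / 2"
          using cos_double_sin[of "t * x / 2"]
            power_mono[OF abs_sin_x_le_abs_x[of "t * x / 2"], of 2]
          by (simp add: power_divide)
        thus ?thesis using False by (simp add: power_mult_distrib)
      qed
    qed (use int_cos square_integrable integrable_tail in auto)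
    also have "\<dots> = Re (char (\<mu> l) t) - 1 + t\<^sup>2 / 2 * ?v l"
      using int_cos square_integrable \<mu>.prob_space[of l] unfolding Re_char by simp
    finally show ?thesis by simp
  qed
  have "?L l \<ge> 0" for l by (intro integral_nonneg_AE) auto
  have "(\<lambda>l. 2 / \<eta>\<^sup>2 * (real (k l) * ?L l)) \<longlonglongrightarrow> 0"
  proof (rule tendsto_sandwich[OF _ _ tendsto_const lim])
    show "\<forall>\<^sub>F l in sequentially. 0 \<le> 2 / \<eta>\<^sup>2 * (real (k l) * ?L l)"
      using \<open>\<And>l. ?L l \<ge> 0\<close> by simp
    show "\<forall>\<^sub>F l in sequentially. 2 / \<eta>\<^sup>2 * (real (k l) * ?L l)
        \<le> real (k l) * (Re (char (\<mu> l) t) - 1 + t\<^sup>2 / 2 * ?v l)"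
      using mult_left_mono[OF bound, of "real (k _)"] by (simp add: mult_ac)
  qed
  from tendsto_mult_left[OF this, of "\<eta>\<^sup>2 / 2"] show ?thesis
    using \<open>\<eta> > 0\<close> by (simp add: field_simps)
qed

end

section \<open>Convergence to the normal law\<close>

lemma normal_cdf_eq_cdf: "normal_cdf t = cdf std_normal_distribution t"
proof -
  interpret real_distribution std_normal_distribution
    by (rule real_dist_normal_dist)
  have int: "integrable lborel (\<lambda>u. indicator {..t} u * std_normal_density u)"
    using integrable_normal_density[of 1 0]
    by (intro integrable_real_mult_indicator[unfolded mult.commute[of _ "indicator _ _"]]) auto
  have "ennreal (cdf std_normal_distribution t)
      = (\<integral>\<^sup>+u. ennreal (indicator {..t} u * std_normal_density u) \<partial>lborel)"
    unfolding cdf_def emeasure_eq_measure[symmetric]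
    by (subst emeasure_density) (auto intro!: nn_integral_cong simp: indicator_def)
  also have "\<dots> = ennreal (\<integral>u. indicator {..t} u * std_normal_density u \<partial>lborel)"
    by (rule nn_integral_eq_integral[OF int]) simp
  finally have "cdf std_normal_distribution t = (LBINT u:{..t}. std_normal_density u)"
    unfolding set_lebesgue_integral_def real_scaleR_def
    by (subst (asm) ennreal_inj) (auto simp: cdf_nonneg intro!: integral_nonneg_AE)
  also have "\<dots> = normal_cdf t"
    unfolding normal_cdf_def std_normal_density_def by simp
  finally show ?thesis ..
qed

text \<open>
  Weak convergence only concerns continuity points of the limit distribution; here these are all
  the reals.
\<close>

lemma isCont_cdf_std_normal: "isCont (cdf std_normal_distribution) t"
proof -
  interpret real_distribution std_normal_distribution
    by (rule real_dist_normal_dist)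
  have "emeasure std_normal_distribution {t} = 0"
    by (subst emeasure_density) (auto intro!: nn_integral_null_set)
  thus ?thesis by (simp add: isCont_cdf measure_def)
qed

lemma cdf_lim_normal_iff_char_lim:
  assumes "\<And>l. real_distribution (\<mu> l)"
  shows "(\<forall>t. (\<lambda>l. cdf (\<mu> l) t) \<longlonglongrightarrow> normal_cdf t) \<longleftrightarrow>
    (\<forall>t. (\<lambda>l. char (\<mu> l) t) \<longlonglongrightarrow> exp (- (t\<^sup>2) / 2))"
proof -
  have "(\<forall>t. (\<lambda>l. cdf (\<mu> l) t) \<longlonglongrightarrow> normal_cdf t) \<longleftrightarrow> weak_conv_m \<mu> std_normal_distribution"
    by (simp add: weak_conv_m_def weak_conv_def normal_cdf_eq_cdf isCont_cdf_std_normal)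
  also have "\<dots> \<longleftrightarrow> (\<forall>t. (\<lambda>l. char (\<mu> l) t) \<longlonglongrightarrow> char std_normal_distribution t)"
    using levy_continuity1[of \<mu>, OF assms real_dist_normal_dist]
      levy_continuity[of \<mu>, OF assms real_dist_normal_dist]
    by blast
  finally show ?thesis by (simp add: char_std_normal_distribution)
qed

text \<open>
  Perturbations that are small in \<open>L\<^sup>1\<close> do not affect limits of characteristic functions.  The
  bound plays the part of Slutsky's lemma; being quantitative, it can be used along a sequence of
  different probability spaces.
\<close>

lemma (in prob_space) norm_char_distr_diff_le:
  assumes [measurable]: "random_variable borel X" "random_variable borel Y"
    and "integrable M (\<lambda>p. X p - Y p)"
  shows "norm (char (distr M borel X) t - char (distr M borel Y) t) \<le> \<bar>t\<bar> * expectation (\<lambda>p. \<bar>X p - Y p\<bar>)"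
proof -
  have lipschitz: "norm (iexp u - iexp v) \<le> \<bar>u - v\<bar>" for u v :: real
  proof -
    have "iexp u - iexp v = iexp v * (iexp (u - v) - 1)"
      by (simp add: algebra_simps flip: exp_add)
    thus ?thesis using iexp_approx1[of "u - v" 0] by (simp add: norm_mult)
  qed
  have int: "integrable M (\<lambda>p. iexp (t * X p))" "integrable M (\<lambda>p. iexp (t * Y p))"
    by (rule integrable_iexp; measurable)+
  have "char (distr M borel X) t - char (distr M borel Y) t
      = expectation (\<lambda>p. iexp (t * X p) - iexp (t * Y p))"
    using int by (simp add: char_def integral_distr)
  also have "norm \<dots> \<le> expectation (\<lambda>p. norm (iexp (t * X p) - iexp (t * Y p)))"
    by (rule integral_norm_bound)
  also have "\<dots> \<le> expectation (\<lambda>p. \<bar>t\<bar> * \<bar>X p - Y p\<bar>)"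
    using assms int lipschitz[of "t * X _" "t * Y _"]
    by (intro integral_mono) (auto simp flip: right_diff_distrib abs_mult)
  finally show ?thesis by simp
qed

section \<open>Uniform probabilities on finite sets\<close>

lemma prob_space_unif: "finite Z \<Longrightarrow> Z \<noteq> {} \<Longrightarrow> prob_space (unif Z)"
  by (simp add: unif_def prob_space_uniform_count_measure)

lemma space_unif [simp]: "space (unif Z) = Z"
  by (simp add: unif_def space_uniform_count_measure)

lemma sets_unif [simp, measurable_cong]: "sets (unif Z) = sets (count_space Z)"
  by (simp add: unif_def sets_uniform_count_measure)

lemma integrable_unif [simp]:
  fixes f :: "'a \<Rightarrow> 'b::{banach, second_countable_topology}"
  shows "finite Z \<Longrightarrow> integrable (unif Z) f"
  by (simp add: unif_def uniform_count_measure_def integrable_point_measure_finite)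

lemma integral_unif:
  fixes f :: "'a \<Rightarrow> 'b::{banach, second_countable_topology}"
  shows "finite Z \<Longrightarrow> (\<integral>p. f p \<partial>unif Z) = (\<Sum>p\<in>Z. f p) /\<^sub>R card Z"
  by (simp add: unif_def uniform_count_measure_def lebesgue_integral_point_measure_finite
      scaleR_sum_right divide_inverse)

lemma expect_eq_sum: "finite Z \<Longrightarrow> expect Z f = (\<Sum>p\<in>Z. f p) / card Z"
  by (simp add: expect_def unif_def integral_uniform_count_measure)

lemma expect_cong: "(\<And>p. p \<in> Z \<Longrightarrow> f p = g p) \<Longrightarrow> expect Z f = expect Z g"
  unfolding expect_def by (rule Bochner_Integration.integral_cong) simp_all

lemma expect_mono: "finite Z \<Longrightarrow> (\<And>p. p \<in> Z \<Longrightarrow> f p \<le> g p) \<Longrightarrow> expect Z f \<le> expect Z g"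
  unfolding expect_def by (rule integral_mono) simp_all

lemma expect_nonneg: "finite Z \<Longrightarrow> (\<And>p. p \<in> Z \<Longrightarrow> f p \<ge> 0) \<Longrightarrow> expect Z f \<ge> 0"
  by (simp add: expect_eq_sum sum_nonneg)

lemma expect_linear:
  assumes "finite Z"
  shows expect_add: "expect Z (\<lambda>p. f p + g p) = expect Z f + expect Z g"
    and expect_diff: "expect Z (\<lambda>p. f p - g p) = expect Z f - expect Z g"
    and expect_cmult: "expect Z (\<lambda>p. c * f p) = c * expect Z f"
    and expect_divide: "expect Z (\<lambda>p. f p / c) = expect Z f / c"
    and expect_sum: "expect Z (\<lambda>p. \<Sum>i\<in>I. F i p) = (\<Sum>i\<in>I. expect Z (F i))"
  using assms by (simp_all add: expect_def)

lemma expect_const: "finite Z \<Longrightarrow> Z \<noteq> {} \<Longrightarrow> expect Z (\<lambda>p. c) = c"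
  by (simp add: expect_eq_sum)

lemma var_nonneg: "var Z f \<ge> 0"
  by (simp add: var_def)

lemma var_eq_expect: "var Z f = expect Z (\<lambda>p. (f p - expect Z f)\<^sup>2)"
  by (simp add: var_def expect_def)

lemma var_le_expect_square:
  assumes "finite Z"
  shows "var Z f \<le> expect Z (\<lambda>p. (f p)\<^sup>2)"
proof (cases "Z = {}")
  case False
  let ?m = "expect Z f"
  have "var Z f = expect Z (\<lambda>p. (f p)\<^sup>2 - 2 * ?m * f p + ?m\<^sup>2)"
    unfolding var_eq_expect by (rule expect_cong) (simp add: power2_diff)
  also have "\<dots> = expect Z (\<lambda>p. (f p)\<^sup>2) - ?m\<^sup>2"
    by (simp add: expect_linear expect_const assms False power2_eq_square)
  finally show ?thesis by simp
qed (simp add: var_eq_expect expect_eq_sum)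

text \<open>
  Cauchy--Schwarz, in the form that the variance of \<open>\<bar>f\<bar>\<close> is nonnegative.
\<close>

lemma expect_abs_le_sqrt_expect_square:
  assumes "finite Z" "Z \<noteq> {}"
  shows "expect Z (\<lambda>p. \<bar>f p\<bar>) \<le> sqrt (expect Z (\<lambda>p. (f p)\<^sup>2))"
proof (rule real_le_rsqrt)
  let ?m = "expect Z (\<lambda>p. \<bar>f p\<bar>)"
  have "0 \<le> var Z (\<lambda>p. \<bar>f p\<bar>)" by (rule var_nonneg)
  also have "\<dots> = expect Z (\<lambda>p. (f p)\<^sup>2 - 2 * ?m * \<bar>f p\<bar> + ?m\<^sup>2)"
    unfolding var_eq_expect by (rule expect_cong) (simp add: power2_diff)
  also have "\<dots> = expect Z (\<lambda>p. (f p)\<^sup>2) - ?m\<^sup>2"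
    by (simp add: expect_linear expect_const assms power2_eq_square)
  finally show "?m\<^sup>2 \<le> expect Z (\<lambda>p. (f p)\<^sup>2)" by simp
qed

lemma lindeberg_eq_expect:
  "lindeberg Z f \<eta> = expect Z (\<lambda>p. (f p - expect Z f)\<^sup>2 * indicator {x. \<bar>x\<bar> > \<eta>} (f p - expect Z f))"
  unfolding lindeberg_def expect_def by (simp add: indicator_def)

text \<open>
  Let \<open>u\<close> and \<open>v\<close> be the centred values of \<open>f\<close> and \<open>g\<close>.  If \<open>\<bar>u\<bar> > \<eta>\<close>, then either \<open>\<bar>v\<bar>\<close> is at least
  \<open>\<bar>u\<bar> / 2 > \<eta> / 2\<close>, and \<open>u\<^sup>2\<close> is charged to the tail of \<open>v\<close>, or \<open>u\<^sup>2\<close> is charged to \<open>(u - v)\<^sup>2\<close>.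
\<close>

lemma lindeberg_le_lindeberg_add:
  assumes "finite Z"
  shows "lindeberg Z f \<eta> \<le> 4 * lindeberg Z g (\<eta> / 2) + 4 * expect Z (\<lambda>p. (f p - g p)\<^sup>2)"
proof -
  let ?tail = "\<lambda>\<eta>. indicator {x::real. \<bar>x\<bar> > \<eta>} :: real \<Rightarrow> real"
  have pointwise: "u\<^sup>2 * ?tail \<eta> u \<le> 4 * (v\<^sup>2 * ?tail (\<eta> / 2) v) + 4 * (u - v)\<^sup>2" for u v :: real
  proof (cases "\<bar>u\<bar> \<le> \<eta>")
    case False
    show ?thesis
    proof (cases "\<bar>u\<bar> \<le> 2 * \<bar>v\<bar>")
      case True
      hence "u\<^sup>2 \<le> (2 * \<bar>v\<bar>)\<^sup>2" by (metis abs_ge_zero power2_abs power_mono)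
      thus ?thesis using True False by (simp add: power_mult_distrib add_increasing2)
    next
      case *: False
      hence "\<bar>u\<bar> \<le> 2 * \<bar>u - v\<bar>"
        by (smt (verit))
      hence "u\<^sup>2 \<le> (2 * \<bar>u - v\<bar>)\<^sup>2" by (metis abs_ge_zero power2_abs power_mono)
      thus ?thesis using False by (simp add: power_mult_distrib add_increasing)
    qed
  qed (simp add: indicator_def)
  let ?u = "\<lambda>p. f p - expect Z f" and ?v = "\<lambda>p. g p - expect Z g"
  have "lindeberg Z f \<eta> \<le> expect Z (\<lambda>p. 4 * ((?v p)\<^sup>2 * ?tail (\<eta> / 2) (?v p)) + 4 * (?u p - ?v p)\<^sup>2)"
    unfolding lindeberg_eq_expect by (intro expect_mono assms pointwise)
  also have "\<dots> = 4 * lindeberg Z g (\<eta> / 2) + 4 * expect Z (\<lambda>p. (?u p - ?v p)\<^sup>2)"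
    unfolding lindeberg_eq_expect by (simp add: expect_linear assms)
  also have "expect Z (\<lambda>p. (?u p - ?v p)\<^sup>2) = var Z (\<lambda>p. f p - g p)"
    unfolding var_eq_expect expect_diff[OF assms] by (simp add: algebra_simps)
  also have "\<dots> \<le> expect Z (\<lambda>p. (f p - g p)\<^sup>2)"
    by (rule var_le_expect_square[OF assms])
  finally show ?thesis by simp
qed

text \<open>
  The free parameter \<open>\<delta>\<close> (from \<open>2 * \<bar>u * d\<bar> \<le> \<delta> * u\<^sup>2 + d\<^sup>2 / \<delta>\<close>) lets the estimate be summed over blocks:
  the first term then becomes \<open>\<delta>\<close> times the total variance.
\<close>

lemma abs_var_diff_le:
  assumes "finite Z" "\<delta> > 0"
  shows "\<bar>var Z g - var Z f\<bar> \<le> \<delta> * var Z f + (1 + 1 / \<delta>) * expect Z (\<lambda>p. (f p - g p)\<^sup>2)"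
proof -
  let ?u = "\<lambda>p. f p - expect Z f" and ?v = "\<lambda>p. g p - expect Z g"
  have pointwise: "\<bar>v\<^sup>2 - u\<^sup>2\<bar> \<le> \<delta> * u\<^sup>2 + (1 + 1 / \<delta>) * (u - v)\<^sup>2" for u v :: real
  proof -
    define d where "d = v - u"
    have "0 \<le> \<delta> * (\<bar>u\<bar> - \<bar>d\<bar> / \<delta>)\<^sup>2" using assms by simp
    also have "\<dots> = \<delta> * u\<^sup>2 - 2 * \<bar>u * d\<bar> + 1 / \<delta> * d\<^sup>2"
      using assms by (simp add: power2_eq_square field_simps abs_mult)
    finally have "2 * \<bar>u * d\<bar> \<le> \<delta> * u\<^sup>2 + 1 / \<delta> * d\<^sup>2" by simp
    moreover have "v\<^sup>2 - u\<^sup>2 = 2 * (u * d) + d\<^sup>2" "(u - v)\<^sup>2 = d\<^sup>2"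
      by (simp_all add: d_def power2_eq_square algebra_simps)
    moreover have "\<bar>2 * (u * d) + d\<^sup>2\<bar> \<le> 2 * \<bar>u * d\<bar> + d\<^sup>2"
      using abs_triangle_ineq[of "2 * (u * d)" "d\<^sup>2"] by (simp add: abs_mult)
    moreover have "(1 + 1 / \<delta>) * d\<^sup>2 = d\<^sup>2 + 1 / \<delta> * d\<^sup>2"
      by (simp add: distrib_right)
    ultimately show ?thesis by simp
  qed
  have "\<bar>var Z g - var Z f\<bar> = \<bar>expect Z (\<lambda>p. (?v p)\<^sup>2 - (?u p)\<^sup>2)\<bar>"
    by (simp add: var_eq_expect expect_linear assms)
  also have "\<dots> \<le> expect Z (\<lambda>p. \<bar>(?v p)\<^sup>2 - (?u p)\<^sup>2\<bar>)"
    unfolding expect_def by (rule integral_abs_bound)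
  also have "\<dots> \<le> expect Z (\<lambda>p. \<delta> * (?u p)\<^sup>2 + (1 + 1 / \<delta>) * (?u p - ?v p)\<^sup>2)"
    by (intro expect_mono assms pointwise)
  also have "\<dots> = \<delta> * var Z f + (1 + 1 / \<delta>) * expect Z (\<lambda>p. (?u p - ?v p)\<^sup>2)"
    by (simp only: var_eq_expect expect_linear assms)
  also have "expect Z (\<lambda>p. (?u p - ?v p)\<^sup>2) = var Z (\<lambda>p. f p - g p)"
    unfolding var_eq_expect expect_diff[OF assms(1)] by (simp add: algebra_simps)
  also have "(1 + 1 / \<delta>) * \<dots> \<le> (1 + 1 / \<delta>) * expect Z (\<lambda>p. (f p - g p)\<^sup>2)"
    using assms by (intro mult_left_mono var_le_expect_square) auto
  finally show ?thesis by simp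
qed

text \<open>
  If \<open>Z\<close> is in bijection with a power of \<open>E\<close>, then the uniform probability on \<open>Z\<close> is a product measure:
  the coordinates \<open>x p i\<close> of a random point \<open>p\<close> are independent and uniformly distributed on \<open>E\<close>.  The
  product formula below says this for product test functions, which is enough to identify the
  marginals and the characteristic function of a sum over the coordinates.
\<close>

lemma integral_prod_coordinates:
  fixes f :: "'i \<Rightarrow> 'a \<Rightarrow> 'b::{banach, second_countable_topology, real_normed_field}"
  assumes "finite I" "finite E" "finite Z"
    and bij: "bij_betw x Z (I \<rightarrow>\<^sub>E E)"
  shows "(\<integral>p. (\<Prod>i\<in>I. f i (x p i)) \<partial>unif Z) = (\<Prod>i\<in>I. \<integral>e. f i e \<partial>unif E)"
proof -
  have "(\<Sum>p\<in>Z. \<Prod>i\<in>I. f i (x p i)) = (\<Sum>y\<in>I \<rightarrow>\<^sub>E E. \<Prod>i\<in>I. f i (y i))"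
    by (rule sum.reindex_bij_betw[OF bij, of "\<lambda>y. \<Prod>i\<in>I. f i (y i)"])
  also have "\<dots> = (\<Prod>i\<in>I. \<Sum>e\<in>E. f i e)"
    using assms by (simp add: prod_sum_PiE)
  finally have "(\<Sum>p\<in>Z. \<Prod>i\<in>I. f i (x p i)) = (\<Prod>i\<in>I. \<Sum>e\<in>E. f i e)" .
  moreover have "card Z = card E ^ card I"
    using bij_betw_same_card[OF bij] assms by (simp add: card_PiE)
  ultimately show ?thesis
    using assms by (simp add: integral_unif scaleR_conv_of_real prod.distrib power_inverse)
qed

lemma expect_coordinate:
  assumes "finite I" "finite E" "E \<noteq> {}" "finite Z" "i \<in> I"
    and bij: "bij_betw x Z (I \<rightarrow>\<^sub>E E)"
  shows "expect Z (\<lambda>p. f (x p i)) = expect E f"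
proof -
  let ?f = "\<lambda>j. if j = i then f else (\<lambda>_. 1)"
  have "(\<Prod>j\<in>I. ?f j (x p j)) = f (x p i)" for p
    using assms by (subst prod.remove[of I i]) (auto intro!: prod.neutral)
  hence "expect Z (\<lambda>p. f (x p i)) = (\<Prod>j\<in>I. expect E (?f j))"
    unfolding expect_def
    using integral_prod_coordinates[OF assms(1,2,4) bij, of ?f] by simp
  also have "\<dots> = expect E f"
    using assms by (subst prod.remove[of I i]) (auto intro!: prod.neutral simp: expect_const)
  finally show ?thesis .
qed

lemma char_sum_coordinates:
  assumes "finite I" "finite E" "finite Z"
    and bij: "bij_betw x Z (I \<rightarrow>\<^sub>E E)"
  shows "char (distr (unif Z) borel (\<lambda>p. \<Sum>i\<in>I. g (x p i))) t
    = char (distr (unif E) borel g) t ^ card I"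
  using integral_prod_coordinates[OF assms, of "\<lambda>i e. iexp (t * g e)"]
  by (simp add: char_def integral_distr exp_sum sum_distrib_left sum_distrib_right assms)

section \<open>Arrays of blocks close to independent rows\<close>

text \<open>
  The probabilistic content of the theorem, without the dynamics.  The map \<open>x l\<close> identifies \<open>Z l\<close> with
  a power of \<open>E l\<close>; the block variables \<open>X l i\<close>, which need not be independent, are close on average to
  the function \<open>g l\<close> of the \<open>i\<close>-th coordinate; \<open>R l\<close> is the contribution of the gaps between blocks.
\<close>

locale block_array =
  fixes Z E :: "nat \<Rightarrow> 'a set"
    and x :: "nat \<Rightarrow> 'a \<Rightarrow> nat \<Rightarrow> 'a"
    and k :: "nat \<Rightarrow> nat"
    and X :: "nat \<Rightarrow> nat \<Rightarrow> 'a \<Rightarrow> real"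
    and g R :: "nat \<Rightarrow> 'a \<Rightarrow> real"
    and s :: "nat \<Rightarrow> real"
  assumes finite_E: "\<And>l. finite (E l)" and finite_Z: "\<And>l. finite (Z l)"
    and nonempty_E: "\<And>l. E l \<noteq> {}" and nonempty_Z: "\<And>l. Z l \<noteq> {}"
    and bij: "\<And>l. bij_betw (x l) (Z l) ({1..k l} \<rightarrow>\<^sub>E E l)"
    and k_at_top: "filterlim k at_top sequentially"
    and s_pos: "\<And>l. s l > 0"
    and s_square: "\<And>l. (s l)\<^sup>2 = (\<Sum>i = 1..k l. var (Z l) (X l i))"
    and L1_lim: "(\<lambda>l. (\<Sum>i = 1..k l. expect (Z l) (\<lambda>p. \<bar>X l i p - g l (x l p i)\<bar>)) / s l) \<longlonglongrightarrow> 0"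
    and L2_lim: "(\<lambda>l. (\<Sum>i = 1..k l. expect (Z l) (\<lambda>p. (X l i p - g l (x l p i))\<^sup>2)) / (s l)\<^sup>2) \<longlonglongrightarrow> 0"
    and gap_lim: "(\<lambda>l. 1 / (s l)\<^sup>2 * var (Z l) (R l)) \<longlonglongrightarrow> 0"
begin

definition std_obs :: "nat \<Rightarrow> 'a \<Rightarrow> real"
  where "std_obs l e = (g l e - expect (E l) (g l)) / s l"

text \<open>
  The common law of the entries of the comparison array.  They are divided by \<open>s l\<close>, the
  normalisation of the blocks \<open>X l i\<close>, and so have total variance tending to \<open>1\<close>.
\<close>

definition \<mu> :: "nat \<Rightarrow> real measure"
  where "\<mu> l = distr (unif (E l)) borel (std_obs l)"

lemma expect_coord:
  "i \<in> {1..k l} \<Longrightarrow> expect (Z l) (\<lambda>p. f (x l p i)) = expect (E l) f"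
  by (rule expect_coordinate[OF _ finite_E nonempty_E finite_Z _ bij]) simp_all

lemma sum_var_coord:
  "(\<Sum>i = 1..k l. var (Z l) (\<lambda>p. g l (x l p i))) = real (k l) * var (E l) (g l)"
proof -
  have "var (Z l) (\<lambda>p. g l (x l p i)) = var (E l) (g l)" if "i \<in> {1..k l}" for i
    unfolding var_eq_expect expect_coord[OF that] by (rule expect_coord[OF that])
  thus ?thesis by simp
qed

lemma sum_lindeberg_coord:
  "(\<Sum>i = 1..k l. lindeberg (Z l) (\<lambda>p. g l (x l p i)) \<eta>) = real (k l) * lindeberg (E l) (g l) \<eta>"
proof -
  have "lindeberg (Z l) (\<lambda>p. g l (x l p i)) \<eta> = lindeberg (E l) (g l) \<eta>" if "i \<in> {1..k l}" for i
    unfolding lindeberg_eq_expect expect_coord[OF that]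
    by (rule expect_coord[OF that,
        where f = "\<lambda>e. (g l e - expect (E l) (g l))\<^sup>2 * indicator {x. \<bar>x\<bar> > \<eta>} (g l e - expect (E l) (g l))"])
  thus ?thesis by simp
qed

lemma integral_\<mu>: "f \<in> borel_measurable borel \<Longrightarrow> (LINT y|\<mu> l. f y) = expect (E l) (\<lambda>e. f (std_obs l e))"
  for f :: "real \<Rightarrow> real"
  by (simp add: \<mu>_def integral_distr expect_def)

lemma second_moment_\<mu>: "(LINT y|\<mu> l. y\<^sup>2) = var (E l) (g l) / (s l)\<^sup>2"
  by (simp add: integral_\<mu> std_obs_def power_divide expect_divide finite_E var_eq_expect)

lemma tail_\<mu>:
  "(LINT y|\<mu> l. y\<^sup>2 * indicator {y. \<bar>y\<bar> > \<eta>} y) = lindeberg (E l) (g l) (\<eta> * s l) / (s l)\<^sup>2"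
proof -
  have "(std_obs l e)\<^sup>2 * indicator {y. \<bar>y\<bar> > \<eta>} (std_obs l e) =
      ((g l e - expect (E l) (g l))\<^sup>2 *
        indicator {y. \<bar>y\<bar> > \<eta> * s l} (g l e - expect (E l) (g l))) / (s l)\<^sup>2" for e
    using s_pos[of l] by (simp add: std_obs_def indicator_def power_divide field_simps)
  thus ?thesis
    by (simp add: integral_\<mu> lindeberg_eq_expect expect_divide finite_E)
qed

text \<open>
  By the \<open>L\<^sup>2\<close> closeness, the blocks and the comparison variables have asymptotically equal total
  variances.
\<close>

lemma variance_coord_lim: "(\<lambda>l. real (k l) * (LINT y|\<mu> l. y\<^sup>2)) \<longlonglongrightarrow> 1"
proof -
  let ?D = "\<lambda>l. (\<Sum>i = 1..k l. expect (Z l) (\<lambda>p. (X l i p - g l (x l p i))\<^sup>2)) / (s l)\<^sup>2"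
  have bound: "\<bar>real (k l) * (LINT y|\<mu> l. y\<^sup>2) - 1\<bar> \<le> \<delta> + (1 + 1 / \<delta>) * ?D l" if "\<delta> > 0" for \<delta> l
  proof -
    let ?Y = "\<lambda>i p. g l (x l p i)"
    have "\<bar>real (k l) * var (E l) (g l) - (s l)\<^sup>2\<bar>
        = \<bar>\<Sum>i = 1..k l. var (Z l) (?Y i) - var (Z l) (X l i)\<bar>"
      by (simp add: sum_var_coord[symmetric] s_square sum_subtractf)
    also have "\<dots> \<le> (\<Sum>i = 1..k l. \<bar>var (Z l) (?Y i) - var (Z l) (X l i)\<bar>)"
      by (rule sum_abs)
    also have "\<dots> \<le> (\<Sum>i = 1..k l. \<delta> * var (Z l) (X l i) +
        (1 + 1 / \<delta>) * expect (Z l) (\<lambda>p. (X l i p - ?Y i p)\<^sup>2))"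
      by (intro sum_mono abs_var_diff_le finite_Z that)
    also have "\<dots> = (\<delta> + (1 + 1 / \<delta>) * ?D l) * (s l)\<^sup>2"
      using s_pos[of l] unfolding sum.distrib sum_distrib_left[symmetric] s_square[symmetric]
      by (simp add: field_simps)
    finally have "\<bar>real (k l) * var (E l) (g l) - (s l)\<^sup>2\<bar> / (s l)\<^sup>2 \<le> \<delta> + (1 + 1 / \<delta>) * ?D l"
      using s_pos[of l] by (simp add: divide_le_eq)
    moreover have "real (k l) * (LINT y|\<mu> l. y\<^sup>2) - 1 = (real (k l) * var (E l) (g l) - (s l)\<^sup>2) / (s l)\<^sup>2"
      using s_pos[of l] by (simp add: second_moment_\<mu> diff_divide_distrib)
    ultimately show ?thesis by simp
  qed
  show ?thesis
  proof (rule tendstoI)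
    fix e :: real assume "e > 0"
    have "(\<lambda>l. e / 2 + (1 + 1 / (e / 2)) * ?D l) \<longlonglongrightarrow> e / 2 + (1 + 1 / (e / 2)) * 0"
      by (intro tendsto_intros L2_lim)
    hence "\<forall>\<^sub>F l in sequentially. e / 2 + (1 + 1 / (e / 2)) * ?D l < e"
      by (rule order_tendstoD) (use \<open>e > 0\<close> in simp)
    thus "\<forall>\<^sub>F l in sequentially. dist (real (k l) * (LINT y|\<mu> l. y\<^sup>2)) 1 < e"
      by (rule eventually_mono)
         (unfold dist_real_def, rule le_less_trans[OF bound[of "e / 2"]], use \<open>e > 0\<close> in simp_all)
  qed
qed

sublocale rows: centred_L2_rows \<mu> k
proof (rule centred_L2_rows.intro)
  interpret E: prob_space "unif (E l)" for l
    by (rule prob_space_unif[OF finite_E nonempty_E])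
  fix l
  show "real_distribution (\<mu> l)"
    unfolding \<mu>_def by (rule E.real_distribution_distr) simp
  show "integrable (\<mu> l) (\<lambda>y. y\<^sup>2)"
    by (simp add: \<mu>_def integrable_distr_eq finite_E)
  show "(LINT y|\<mu> l. y) = 0"
    by (simp add: integral_\<mu> std_obs_def expect_linear expect_const finite_E nonempty_E)
qed (fact k_at_top variance_coord_lim)+

text \<open>
  The comparison of Lindeberg functions is symmetric in the two families, so the condition passes
  in both directions at the cost of halving \<open>\<eta>\<close>.
\<close>

lemma lindeberg_iff_lindeberg_coord:
  "(\<forall>\<eta>>0. (\<lambda>l. 1 / (s l)\<^sup>2 * (\<Sum>i = 1..k l. lindeberg (Z l) (X l i) (\<eta> * s l))) \<longlonglongrightarrow> 0) \<longleftrightarrow>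
   (\<forall>\<eta>>0. (\<lambda>l. real (k l) * (LINT y|\<mu> l. y\<^sup>2 * indicator {y. \<bar>y\<bar> > \<eta>} y)) \<longlonglongrightarrow> 0)"
proof -
  let ?D = "\<lambda>l. (\<Sum>i = 1..k l. expect (Z l) (\<lambda>p. (X l i p - g l (x l p i))\<^sup>2)) / (s l)\<^sup>2"
  have transfer: "\<forall>\<eta>>0. (\<lambda>l. (\<Sum>i = 1..k l. lindeberg (Z l) (F l i) (\<eta> * s l)) / (s l)\<^sup>2) \<longlonglongrightarrow> 0"
    if G: "\<forall>\<eta>>0. (\<lambda>l. (\<Sum>i = 1..k l. lindeberg (Z l) (G l i) (\<eta> * s l)) / (s l)\<^sup>2) \<longlonglongrightarrow> 0"
      and D: "\<And>l i p. (F l i p - G l i p)\<^sup>2 = (X l i p - g l (x l p i))\<^sup>2"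
    for F G :: "nat \<Rightarrow> nat \<Rightarrow> 'a \<Rightarrow> real"
  proof (intro allI impI)
    fix \<eta> :: real assume "\<eta> > 0"
    let ?b = "\<lambda>l. 4 * ((\<Sum>i = 1..k l. lindeberg (Z l) (G l i) (\<eta> / 2 * s l)) / (s l)\<^sup>2) + 4 * ?D l"
    have "(\<Sum>i = 1..k l. lindeberg (Z l) (F l i) (\<eta> * s l))
        \<le> (\<Sum>i = 1..k l. 4 * lindeberg (Z l) (G l i) (\<eta> * s l / 2) +
            4 * expect (Z l) (\<lambda>p. (F l i p - G l i p)\<^sup>2))" for l
      by (intro sum_mono lindeberg_le_lindeberg_add finite_Z)
    from divide_right_mono[OF this zero_le_power2]
    have upper: "(\<Sum>i = 1..k l. lindeberg (Z l) (F l i) (\<eta> * s l)) / (s l)\<^sup>2 \<le> ?b l" for l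
      unfolding D sum.distrib sum_distrib_left[symmetric] add_divide_distrib by simp
    have lower: "0 \<le> (\<Sum>i = 1..k l. lindeberg (Z l) (F l i) (\<eta> * s l)) / (s l)\<^sup>2" for l
      by (intro divide_nonneg_nonneg sum_nonneg) (auto simp: lindeberg_eq_expect intro!: expect_nonneg finite_Z)
    have "\<eta> / 2 > 0" using \<open>\<eta> > 0\<close> by simp
    hence "?b \<longlonglongrightarrow> 4 * 0 + 4 * 0"
      by (intro tendsto_intros L2_lim G[rule_format])
    hence lim: "?b \<longlonglongrightarrow> 0"
      by simp
    show "(\<lambda>l. (\<Sum>i = 1..k l. lindeberg (Z l) (F l i) (\<eta> * s l)) / (s l)\<^sup>2) \<longlonglongrightarrow> 0"
      by (rule tendsto_sandwich[OF _ _ tendsto_const lim]) (intro always_eventually allI upper lower)+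
  qed
  have "(\<forall>\<eta>>0. (\<lambda>l. (\<Sum>i = 1..k l. lindeberg (Z l) (X l i) (\<eta> * s l)) / (s l)\<^sup>2) \<longlonglongrightarrow> 0) \<longleftrightarrow>
      (\<forall>\<eta>>0. (\<lambda>l. (\<Sum>i = 1..k l. lindeberg (Z l) (\<lambda>p. g l (x l p i)) (\<eta> * s l)) / (s l)\<^sup>2) \<longlonglongrightarrow> 0)"
    (is "?X \<longleftrightarrow> ?Y")
  proof
    show "?X \<Longrightarrow> ?Y" by (erule transfer) (rule power2_commute)
    show "?Y \<Longrightarrow> ?X" by (erule transfer) (rule refl)
  qed
  thus ?thesis
    unfolding tail_\<mu> sum_lindeberg_coord by simp
qed

definition total_sum :: "nat \<Rightarrow> 'a \<Rightarrow> real"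
  where "total_sum l p = (\<Sum>i = 1..k l. X l i p) + R l p"

definition \<nu> :: "nat \<Rightarrow> real measure"
  where "\<nu> l = distr (unif (Z l)) borel (\<lambda>p. (total_sum l p - expect (Z l) (total_sum l)) / s l)"

lemma real_distribution_\<nu>: "real_distribution (\<nu> l)"
  unfolding \<nu>_def
  by (rule prob_space.real_distribution_distr[OF prob_space_unif[OF finite_Z nonempty_Z]]) simp

text \<open>
  The difference of the two normalised sums is the centred sum of the block errors plus the centred
  gap sum.  The former is controlled by the first absolute moments, doubled by centring, and the
  latter by its standard deviation.
\<close>

lemma expect_abs_total_sub_coord_le:
  "expect (Z l) (\<lambda>p. \<bar>(total_sum l p - expect (Z l) (total_sum l)) / s l - (\<Sum>i = 1..k l. std_obs l (x l p i))\<bar>)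
    \<le> 2 * ((\<Sum>i = 1..k l. expect (Z l) (\<lambda>p. \<bar>X l i p - g l (x l p i)\<bar>)) / s l)
      + sqrt (1 / (s l)\<^sup>2 * var (Z l) (R l))"
proof -
  note lin = expect_linear[OF finite_Z[of l]] expect_const[OF finite_Z nonempty_Z, of l]
  let ?d = "\<lambda>i p. X l i p - g l (x l p i)"
  let ?r = "\<lambda>p. R l p - expect (Z l) (R l)"
  let ?D = "\<Sum>i = 1..k l. expect (Z l) (\<lambda>p. \<bar>?d i p\<bar>)"
  have expect_total: "expect (Z l) (total_sum l) = (\<Sum>i = 1..k l. expect (Z l) (X l i)) + expect (Z l) (R l)"
    unfolding total_sum_def by (simp add: lin)
  have sum_std: "(\<Sum>i = 1..k l. std_obs l (x l p i)) = (\<Sum>i = 1..k l. g l (x l p i) - expect (E l) (g l)) / s l" for p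
    by (simp add: std_obs_def sum_divide_distrib)
  have "(\<Sum>i = 1..k l. expect (Z l) (?d i)) = (\<Sum>i = 1..k l. expect (Z l) (X l i) - expect (E l) (g l))"
    by (rule sum.cong) (simp_all add: lin expect_coord)
  hence eq: "(total_sum l p - expect (Z l) (total_sum l)) / s l - (\<Sum>i = 1..k l. std_obs l (x l p i))
      = ((\<Sum>i = 1..k l. ?d i p - expect (Z l) (?d i)) + ?r p) / s l" for p
    unfolding expect_total sum_std sum_subtractf[where f = "\<lambda>i. ?d i p"] total_sum_def
    by (simp add: sum_subtractf diff_divide_distrib add_divide_distrib)
  have pointwise: "\<bar>(\<Sum>i = 1..k l. ?d i p - expect (Z l) (?d i)) + ?r p\<bar>
      \<le> (\<Sum>i = 1..k l. \<bar>?d i p\<bar>) + ?D + \<bar>?r p\<bar>" for p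
  proof -
    have "\<bar>?d i p - expect (Z l) (?d i)\<bar> \<le> \<bar>?d i p\<bar> + expect (Z l) (\<lambda>p. \<bar>?d i p\<bar>)" for i
      using integral_abs_bound[of "unif (Z l)" "?d i"] unfolding expect_def[symmetric] by linarith
    hence "(\<Sum>i = 1..k l. \<bar>?d i p - expect (Z l) (?d i)\<bar>) \<le> (\<Sum>i = 1..k l. \<bar>?d i p\<bar>) + ?D"
      unfolding sum.distrib[symmetric] by (rule sum_mono)
    thus ?thesis
      using sum_abs[of "\<lambda>i. ?d i p - expect (Z l) (?d i)" "{1..k l}"]
        abs_triangle_ineq[of "\<Sum>i = 1..k l. ?d i p - expect (Z l) (?d i)" "?r p"] by linarith
  qed
  have "expect (Z l) (\<lambda>p. \<bar>(total_sum l p - expect (Z l) (total_sum l)) / s l - (\<Sum>i = 1..k l. std_obs l (x l p i))\<bar>)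
      = expect (Z l) (\<lambda>p. \<bar>(\<Sum>i = 1..k l. ?d i p - expect (Z l) (?d i)) + ?r p\<bar>) / s l"
    unfolding eq abs_divide abs_of_pos[OF s_pos] by (rule expect_divide[OF finite_Z])
  also have "\<dots> \<le> expect (Z l) (\<lambda>p. (\<Sum>i = 1..k l. \<bar>?d i p\<bar>) + ?D + \<bar>?r p\<bar>) / s l"
    using s_pos[of l] by (intro divide_right_mono expect_mono finite_Z pointwise) simp
  also have "\<dots> = 2 * (?D / s l) + expect (Z l) (\<lambda>p. \<bar>?r p\<bar>) / s l"
    unfolding lin by (simp add: add_divide_distrib)
  also have "\<dots> \<le> 2 * (?D / s l) + sqrt (var (Z l) (R l)) / s l"
    unfolding var_eq_expect using s_pos[of l]
    by (intro add_left_mono divide_right_mono expect_abs_le_sqrt_expect_square finite_Z nonempty_Z) simp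
  also have "sqrt (var (Z l) (R l)) / s l = sqrt (1 / (s l)\<^sup>2 * var (Z l) (R l))"
    using s_pos[of l] by (simp add: real_sqrt_divide)
  finally show ?thesis .
qed

text \<open>
  By independence of the coordinates, the comparison sum has characteristic function
  \<open>char (\<mu> l) t ^ k l\<close>; the \<open>L\<^sup>1\<close> estimate above does the rest.
\<close>

lemma char_\<nu>_sub_char_power_lim: "(\<lambda>l. char (\<nu> l) t - char (\<mu> l) t ^ k l) \<longlonglongrightarrow> 0"
proof (rule Lim_null_comparison)
  let ?D = "\<lambda>l. (\<Sum>i = 1..k l. expect (Z l) (\<lambda>p. \<bar>X l i p - g l (x l p i)\<bar>)) / s l"
  let ?b = "\<lambda>l. \<bar>t\<bar> * (2 * ?D l + sqrt (1 / (s l)\<^sup>2 * var (Z l) (R l)))"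
  show "\<forall>\<^sub>F l in sequentially. norm (char (\<nu> l) t - char (\<mu> l) t ^ k l) \<le> ?b l"
  proof (intro always_eventually allI)
    fix l
    interpret prob_space "unif (Z l)"
      by (rule prob_space_unif[OF finite_Z nonempty_Z])
    have "char (\<mu> l) t ^ k l = char (distr (unif (Z l)) borel (\<lambda>p. \<Sum>i = 1..k l. std_obs l (x l p i))) t"
      using char_sum_coordinates[OF _ finite_E finite_Z bij, of l "std_obs l" t] by (simp add: \<mu>_def)
    hence "norm (char (\<nu> l) t - char (\<mu> l) t ^ k l) \<le> \<bar>t\<bar> *
        expect (Z l) (\<lambda>p. \<bar>(total_sum l p - expect (Z l) (total_sum l)) / s l - (\<Sum>i = 1..k l. std_obs l (x l p i))\<bar>)"
      unfolding \<nu>_def expect_def[of _ "\<lambda>p. \<bar>_ p\<bar>"]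
      by (auto intro!: norm_char_distr_diff_le simp: finite_Z)
    also have "\<dots> \<le> ?b l"
      by (intro mult_left_mono expect_abs_total_sub_coord_le) simp
    finally show "norm (char (\<nu> l) t - char (\<mu> l) t ^ k l) \<le> ?b l" .
  qed
  have "?b \<longlonglongrightarrow> \<bar>t\<bar> * (2 * 0 + sqrt 0)"
    by (intro tendsto_intros L1_lim gap_lim)
  thus "?b \<longlonglongrightarrow> 0" by simp
qed

lemma cdf_\<nu>: "cdf (\<nu> l) t = measure (unif (Z l)) {p \<in> Z l. total_sum l p - expect (Z l) (total_sum l) \<le> t * s l}"
proof -
  have "cdf (\<nu> l) t = measure (unif (Z l))
      ((\<lambda>p. (total_sum l p - expect (Z l) (total_sum l)) / s l) -` {..t} \<inter> space (unif (Z l)))"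
    unfolding cdf_def \<nu>_def by (rule measure_distr) auto
  also have "(\<lambda>p. (total_sum l p - expect (Z l) (total_sum l)) / s l) -` {..t} \<inter> space (unif (Z l))
      = {p \<in> Z l. total_sum l p - expect (Z l) (total_sum l) \<le> t * s l}"
    using s_pos[of l] by (auto simp: divide_le_eq)
  finally show ?thesis .
qed

theorem lindeberg_iff_clt:
  "(\<forall>\<eta>>0. (\<lambda>l. 1 / (s l)\<^sup>2 * (\<Sum>i = 1..k l. lindeberg (Z l) (X l i) (\<eta> * s l))) \<longlonglongrightarrow> 0) \<longleftrightarrow>
   (\<forall>t. (\<lambda>l. measure (unif (Z l)) {p \<in> Z l. total_sum l p - expect (Z l) (total_sum l) \<le> t * s l}) \<longlonglongrightarrow> normal_cdf t)"
proof -
  have "(\<forall>\<eta>>0. (\<lambda>l. 1 / (s l)\<^sup>2 * (\<Sum>i = 1..k l. lindeberg (Z l) (X l i) (\<eta> * s l))) \<longlonglongrightarrow> 0) \<longleftrightarrow>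
      (\<forall>t. (\<lambda>l. char (\<mu> l) t ^ k l) \<longlonglongrightarrow> exp (- (t\<^sup>2) / 2))"
    unfolding lindeberg_iff_lindeberg_coord
    by (intro iffI allI impI)
       (rule rows.lindeberg_imp_char_power_lim rows.char_power_lim_imp_lindeberg; simp)+
  also have "\<dots> \<longleftrightarrow> (\<forall>t. (\<lambda>l. char (\<nu> l) t) \<longlonglongrightarrow> exp (- (t\<^sup>2) / 2))"
    by (intro iff_allI iffI) (erule Lim_transform Lim_transform2, rule char_\<nu>_sub_char_power_lim)+
  also have "\<dots> \<longleftrightarrow> (\<forall>t. (\<lambda>l. cdf (\<nu> l) t) \<longlonglongrightarrow> normal_cdf t)"
    by (rule cdf_lim_normal_iff_char_lim[OF real_distribution_\<nu>, symmetric])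
  finally show ?thesis unfolding cdf_\<nu> .
qed

end

section \<open>Birkhoff sums over periodic points\<close>

lemma bowen_dist_commute: "bowen_dist T n u v = bowen_dist T n v u"
  by (simp add: bowen_dist_def dist_commute)

text \<open>
  This is where the oscillation enters: a coordinate point \<open>e\<close> of \<open>p\<close> is periodic and its orbit shadows
  that of \<open>p\<close> along the block, so it competes in the supremum.
\<close>

lemma abs_birkhoff_diff_le_osc:
  assumes "(T ^^ m) p \<in> bowen_ball T n \<delta> e" "\<delta> \<le> \<epsilon>" "e \<in> periodic_pts T"
  shows "ennreal \<bar>birkhoff T m n h p - birkhoff T 0 n h e\<bar> \<le> osc T m n h \<epsilon> p"
  unfolding osc_def
  by (rule SUP_upper) (use assms in \<open>auto simp: bowen_ball_def bowen_dist_commute[of T n e]\<close>)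

lemma expect_le_nn_integral_osc:
  assumes "finite Z"
    and "\<And>p. p \<in> Z \<Longrightarrow> ennreal \<bar>birkhoff T m n h p - f p\<bar> \<le> osc T m n h \<epsilon> p"
  shows "ennreal (expect Z (\<lambda>p. \<bar>birkhoff T m n h p - f p\<bar> ^ j))
    \<le> (\<integral>\<^sup>+p. osc T m n h \<epsilon> p ^ j \<partial>unif Z)"
proof -
  have "ennreal (expect Z (\<lambda>p. \<bar>birkhoff T m n h p - f p\<bar> ^ j))
      = (\<integral>\<^sup>+p. ennreal (\<bar>birkhoff T m n h p - f p\<bar> ^ j) \<partial>unif Z)"
    unfolding expect_def using assms(1) by (subst nn_integral_eq_integral) auto
  also have "\<dots> \<le> (\<integral>\<^sup>+p. osc T m n h \<epsilon> p ^ j \<partial>unif Z)"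
    using assms(2) by (intro nn_integral_mono) (simp add: ennreal_power[symmetric] power_mono)
  finally show ?thesis .
qed

lemma birkhoff_blocks:
  "birkhoff T 0 (k * (n + M)) h p =
    (\<Sum>i = 1..k. birkhoff T ((i - 1) * (n + M)) n h p) +
    (\<Sum>i = 1..k. birkhoff T ((i - 1) * (n + M) + n) M h p)"
proof (induction k)
  case (Suc k)
  let ?f = "\<lambda>i. h ((T ^^ i) p)" and ?N = "k * (n + M)"
  have "sum ?f {0..<?N + n + M} = sum ?f {0..<?N} + sum ?f {?N..<?N + n} + sum ?f {?N + n..<?N + n + M}"
    by (simp add: sum.atLeastLessThan_concat)
  with Suc show ?case
    by (simp add: birkhoff_def add_ac)
qed (simp add: birkhoff_def)

text \<open>
  The bijection is inverted, to read off the coordinates of a point of \<open>Z\<close> as random variables on \<open>Z\<close>.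
\<close>

lemma eps_independent_coordinates:
  fixes T :: "'a::metric_space \<Rightarrow> 'a"
  assumes "eps_independent T \<epsilon> k n M Z"
  obtains E x where "E \<subseteq> period_pts T (n + M)" "bij_betw x Z ({1..k} \<rightarrow>\<^sub>E E)"
    "\<And>p i. p \<in> Z \<Longrightarrow> i \<in> {1..k} \<Longrightarrow> (T ^^ ((i - 1) * (n + M))) p \<in> bowen_ball T n \<epsilon> (x p i)"
proof -
  from assms obtain E \<Phi> where E: "E \<subseteq> period_pts T (n + M)"
    and \<Phi>: "bij_betw \<Phi> ({1..k} \<rightarrow>\<^sub>E E) Z"
    and near: "\<forall>y\<in>{1..k} \<rightarrow>\<^sub>E E. \<forall>i\<in>{1..k}.
      (T ^^ ((i - 1) * (n + M))) (\<Phi> y) \<in> bowen_ball T n \<epsilon> (y i)"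
    unfolding eps_independent_def by (elim conjE exE) (rule that)
  let ?x = "inv_into ({1..k} \<rightarrow>\<^sub>E E) \<Phi>"
  have inv: "?x p \<in> {1..k} \<rightarrow>\<^sub>E E" "\<Phi> (?x p) = p" if "p \<in> Z" for p
    using bij_betw_apply[OF bij_betw_inv_into[OF \<Phi>] that] bij_betw_inv_into_right[OF \<Phi> that] .
  show thesis
  proof (rule that[OF E bij_betw_inv_into[OF \<Phi>]])
    fix p i assume "p \<in> Z" "i \<in> {1..k}"
    thus "(T ^^ ((i - 1) * (n + M))) p \<in> bowen_ball T n \<epsilon> (?x p i)"
      using near[rule_format, OF inv(1)] by (simp only: inv(2))
  qed
qed

theorem theoremA:
  fixes T :: "'a::metric_space \<Rightarrow> 'a"
    and \<epsilon> :: "nat \<Rightarrow> real"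
    and k n M :: "nat \<Rightarrow> nat"
    and Z :: "nat \<Rightarrow> 'a set"
    and h :: "nat \<Rightarrow> 'a \<Rightarrow> real"
    and a :: "nat \<Rightarrow> nat \<Rightarrow> nat"
    and s :: "nat \<Rightarrow> real"
  assumes compact_X: "compact (UNIV :: 'a set)"
    and cont_T: "continuous_on UNIV T"
    and finite_P: "\<And>m. m \<ge> 1 \<Longrightarrow> finite (period_pts T m)"
    and eps_pos: "\<And>l. \<epsilon> l > 0"
    and k_pos: "\<And>l. k l \<ge> 1"
    and n_pos: "\<And>l. n l \<ge> 1"
    and M_pos: "\<And>l. M l \<ge> 1"
    and k_lim: "filterlim k at_top sequentially"
    and indep: "\<And>l. eps_independent T (\<epsilon> l) (k l) (n l) (M l) (Z l)"
    and a_eq: "\<And>l i. a l i = (i - 1) * (n l + M l)"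
    and s_pos: "\<And>l. s l > 0"
    and s_eq: "\<And>l. (s l)\<^sup>2 = (\<Sum>i = 1..k l. var (Z l) (birkhoff T (a l i) (n l) (h l)))"
    and osc_cond: "\<And>j::nat. j \<in> {1, 2} \<Longrightarrow>
      (\<lambda>l. (\<Sum>i = 1..k l. \<integral>\<^sup>+ p. (osc T (a l i) (n l) (h l) (4 * \<epsilon> l) p) ^ j \<partial>unif (Z l))
             / ennreal ((s l) ^ j)) \<longlonglongrightarrow> 0"
    and gap_cond:
      "(\<lambda>l. 1 / (s l)\<^sup>2 *
             var (Z l) (\<lambda>p. \<Sum>i = 1..k l. birkhoff T (a l i + n l) (M l) (h l) p)) \<longlonglongrightarrow> 0"
  shows
    "((\<forall>\<eta>>0. (\<lambda>l. 1 / (s l)\<^sup>2 *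
          (\<Sum>i = 1..k l. lindeberg (Z l) (birkhoff T (a l i) (n l) (h l)) (\<eta> * s l))) \<longlonglongrightarrow> 0)
      \<longrightarrow>
      (\<forall>t. (\<lambda>l. measure (unif (Z l))
          {p \<in> Z l. birkhoff T 0 (k l * (n l + M l)) (h l) p
             - expect (Z l) (birkhoff T 0 (k l * (n l + M l)) (h l)) \<le> t * s l})
        \<longlonglongrightarrow> normal_cdf t))
     \<and>
     ((\<forall>l. var (Z l) (birkhoff T 0 (n l) (h l)) > 0) \<and>
      (\<lambda>l. (\<integral>\<^sup>+ p. (osc T 0 (n l) (h l) (2 * \<epsilon> l) p)\<^sup>2 \<partial>unif (Z l))
             / ennreal (var (Z l) (birkhoff T 0 (n l) (h l)))) \<longlonglongrightarrow> 0
      \<longrightarrow>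
      (\<forall>t. (\<lambda>l. measure (unif (Z l))
          {p \<in> Z l. birkhoff T 0 (k l * (n l + M l)) (h l) p
             - expect (Z l) (birkhoff T 0 (k l * (n l + M l)) (h l)) \<le> t * s l})
        \<longlonglongrightarrow> normal_cdf t)
      \<longrightarrow>
      (\<forall>\<eta>>0. (\<lambda>l. 1 / (s l)\<^sup>2 *
          (\<Sum>i = 1..k l. lindeberg (Z l) (birkhoff T (a l i) (n l) (h l)) (\<eta> * s l))) \<longlonglongrightarrow> 0))"
proof -
  define blocks where "blocks l E x \<longleftrightarrow> E \<subseteq> period_pts T (n l + M l) \<and>
      bij_betw x (Z l) ({1..k l} \<rightarrow>\<^sub>E E) \<and>
      (\<forall>p\<in>Z l. \<forall>i\<in>{1..k l}. (T ^^ a l i) p \<in> bowen_ball T (n l) (\<epsilon> l) (x p i))" for l E x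
  have "\<exists>E x. blocks l E x" for l
  proof (rule eps_independent_coordinates[OF indep[of l]])
    fix E x
    assume "E \<subseteq> period_pts T (n l + M l)" "bij_betw x (Z l) ({1..k l} \<rightarrow>\<^sub>E E)"
      "\<And>p i. p \<in> Z l \<Longrightarrow> i \<in> {1..k l} \<Longrightarrow>
        (T ^^ ((i - 1) * (n l + M l))) p \<in> bowen_ball T (n l) (\<epsilon> l) (x p i)"
    thus ?thesis unfolding blocks_def a_eq by (intro exI[of _ E] exI[of _ x] conjI ballI)
  qed
  then obtain E x where blocks: "\<And>l. blocks l (E l) (x l)" by metis
  have E: "E l \<subseteq> period_pts T (n l + M l)"
    and bij: "bij_betw (x l) (Z l) ({1..k l} \<rightarrow>\<^sub>E E l)"
    and near: "\<And>p i. p \<in> Z l \<Longrightarrow> i \<in> {1..k l} \<Longrightarrow> (T ^^ a l i) p \<in> bowen_ball T (n l) (\<epsilon> l) (x l p i)"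
    for l
    using blocks[of l] unfolding blocks_def by simp_all
  have finite_E: "finite (E l)" for l
    using finite_subset[OF E finite_P] n_pos[of l] by simp
  have finite_Z: "finite (Z l)" for l
    using bij_betw_finite[OF bij[of l]] finite_E by (simp add: finite_PiE)
  \<comment> \<open>An empty \<open>Z l\<close> would give \<open>s l = 0\<close>, since integrals over the empty space vanish.\<close>
  have nonempty_Z: "Z l \<noteq> {}" for l
    using s_eq[of l] s_pos[of l] by (auto simp: var_eq_expect expect_eq_sum)
  have nonempty_E: "E l \<noteq> {}" for l
  proof
    assume "E l = {}"
    hence "{1..k l} \<rightarrow>\<^sub>E E l = {}" using k_pos[of l] by (auto simp: PiE_eq_empty_iff intro: exI[of _ 1])
    thus False using bij[of l] nonempty_Z[of l] by (simp add: bij_betw_def)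
  qed
  have periodic: "x l p i \<in> periodic_pts T" if "p \<in> Z l" "i \<in> {1..k l}" for l p i
  proof -
    have "x l p i \<in> E l"
      using bij_betwE[OF bij[of l]] that by (auto simp: PiE_iff)
    thus ?thesis
      using E[of l] n_pos[of l] unfolding periodic_pts_def by (auto intro!: bexI[of _ "n l + M l"])
  qed
  let ?d = "\<lambda>l i p. birkhoff T (a l i) (n l) (h l) p - birkhoff T 0 (n l) (h l) (x l p i)"
  \<comment> \<open>The oscillation condition lives in \<open>[0, \<infinity>]\<close>; the moments that it bounds are finite.\<close>
  have moment_lim: "(\<lambda>l. (\<Sum>i = 1..k l. expect (Z l) (\<lambda>p. \<bar>?d l i p\<bar> ^ j)) / s l ^ j) \<longlonglongrightarrow> 0"
    if "j \<in> {1, 2}" for j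
  proof -
    let ?m = "\<lambda>l. \<Sum>i = 1..k l. expect (Z l) (\<lambda>p. \<bar>?d l i p\<bar> ^ j)"
    have nonneg: "0 \<le> expect (Z l) (\<lambda>p. \<bar>?d l i p\<bar> ^ j)" for l i
      by (intro expect_nonneg finite_Z) simp
    have "ennreal (?m l / s l ^ j) \<le>
        (\<Sum>i = 1..k l. \<integral>\<^sup>+ p. (osc T (a l i) (n l) (h l) (4 * \<epsilon> l) p) ^ j \<partial>unif (Z l))
          / ennreal (s l ^ j)" for l
    proof -
      have "ennreal (expect (Z l) (\<lambda>p. \<bar>?d l i p\<bar> ^ j))
          \<le> (\<integral>\<^sup>+ p. (osc T (a l i) (n l) (h l) (4 * \<epsilon> l) p) ^ j \<partial>unif (Z l))"
        if "i \<in> {1..k l}" for i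
        using near that periodic that eps_pos[of l]
        by (intro expect_le_nn_integral_osc finite_Z abs_birkhoff_diff_le_osc[where \<delta> = "\<epsilon> l"]) auto
      hence "ennreal (?m l)
          \<le> (\<Sum>i = 1..k l. \<integral>\<^sup>+ p. (osc T (a l i) (n l) (h l) (4 * \<epsilon> l) p) ^ j \<partial>unif (Z l))"
        by (subst sum_ennreal[symmetric]) (auto intro: nonneg sum_mono)
      moreover have "ennreal (?m l / s l ^ j) = ennreal (?m l) / ennreal (s l ^ j)"
        using s_pos[of l] by (simp add: divide_ennreal sum_nonneg nonneg)
      ultimately show ?thesis by (simp add: divide_right_mono_ennreal)
    qed
    hence "(\<lambda>l. ennreal (?m l / s l ^ j)) \<longlonglongrightarrow> 0"
      by (intro tendsto_sandwich[OF _ _ tendsto_const osc_cond[OF that]]) simp_all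
    moreover have "0 \<le> ?m l / s l ^ j" for l
      using s_pos[of l] by (intro divide_nonneg_nonneg sum_nonneg nonneg) simp
    ultimately show ?thesis by (simp add: ennreal_tendsto_0_iff)
  qed
  interpret block_array Z E x k "\<lambda>l i. birkhoff T (a l i) (n l) (h l)" "\<lambda>l. birkhoff T 0 (n l) (h l)"
      "\<lambda>l p. \<Sum>i = 1..k l. birkhoff T (a l i + n l) (M l) (h l) p" s
    by unfold_locales
      (use finite_E finite_Z nonempty_E nonempty_Z bij k_lim s_pos s_eq gap_cond
        moment_lim[of 1] moment_lim[of 2] in simp_all)
  have "total_sum l = birkhoff T 0 (k l * (n l + M l)) (h l)" for l
    by (rule ext) (unfold total_sum_def birkhoff_blocks, simp only: a_eq)
  with lindeberg_iff_clt show ?thesis by simp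
qed

end
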